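(* Consider the standard model of floating point arithmetic satisfying the IEEE 754 standard, with set of floating point numbers $\mathbb{F}$. Let $$A=PHP^T,\qquad v=\widetilde h_{1,0}Pe_1,$$ where $P\in\mathbb{F}^{n\times n}$ is a signed permutation matrix, $\widetilde h_{1,0}\in\mathbb{F}$, and $H\in\mathbb{F}^{n\times n}$ is the upper Hessenberg matrix $$H=\begin{bmatrix}\widetilde h_{1,1} & \dots & \dots & \widetilde h_{1,n}\\ \widetilde h_{2,1} & \ddots & & \vdots\\ & \ddots & \ddots & \vdots\\ & & \widetilde h_{n,n-1} & \widetilde h_{n,n}\end{bmatrix}$$ with $\widetilde h_{j+1,j}>0$ and $\widetilde h_{j+1,j}^2$ within the exponent range, $j=0,\dots,n-1$. Then the Arnoldi algorithm applied to $A$ and $v$ in floating point arithmetic computes exactly. As a consequence, $H_n=H$, where $H_n$ is the upper Hessenberg matrix of the computed Arnoldi coefficients.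
   Context: **Floating point arithmetic.** $\mathbb{F}$ is the set of floating point numbers of an IEEE 754 binary format (e.g. binary64, binary32, binary16), with rounding to nearest. For $\alpha,\beta\in\mathbb{F}$ and a basic operation $\circ$ (addition, subtraction, multiplication, division; similarly the square root), $\mathrm{fl}(\alpha\circ\beta)$ is the floating point number nearest to the exact value; if the exact value is within the exponent range (no overflow or underflow), then $\mathrm{fl}(\alpha\circ\beta)=(\alpha\circ\beta)(1+\delta)$ with $|\delta|\le\mathbf{u}$, where $\mathbf{u}$ is the unit roundoff. A positive real number is within the exponent range if it lies between the smallest positive normalized and the largest finite floating point number. Inner products and matrix-vector products are evaluated as floating point sums of floating point products; the Euclidean norm $\|z\|$ is evaluated as the floating point square root of the floating point sum of the floating point squares of the entries. Signed zeros are identified. **Signed permutation matrix.** A permutation matrix in which the entries $1$ are replaced by $\pm1$. **Arnoldi algorithm** (input: $A\in\mathbb{R}^{n\times n}$, vector $v$). Set $v_1=v/\|v\|$. For $j=1,\dots,n$: $w=Av_j$; for $i=1,\dots,j$: $h_{i,j}=v_i^Tw$, $w=w-h_{i,j}v_i$; then $h_{j+1,j}=\|w\|$ and $v_{j+1}=w/h_{j+1,j}$ (the algorithm stops when $h_{j+1,j}=0$). $H_k$ is the $k\times k$ upper Hessenberg matrix with entries $h_{i,j}$, $1\le i\le j+1$, $i,j\le k$. **Computes exactly.** Every vector and coefficient assigned in the lines of the algorithm, when computed in floating point arithmetic, coincides with the corresponding quantity produced by the algorithm in exact arithmetic. *)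

theory Defs
  imports Complex_Main "HOL-Library.Multiset" "HOL-Combinatorics.Permutations"
    "Jordan_Normal_Form.Matrix"
begin

section \<open>Binary floating point arithmetic with rounding to nearest\<close>

text \<open>
  An IEEE 754 binary format is given by its precision \<open>p\<close> and its maximal exponent \<open>emax\<close>;
  the standard fixes the minimal exponent to be \<open>1 - emax\<close>.  For example binary16, binary32 and
  binary64 are \<open>(11, 15)\<close>, \<open>(24, 127)\<close> and \<open>(53, 1023)\<close>.  The set below consists of the finite
  floating point numbers, seen as real numbers (so the two zeros are identified); it contains
  the subnormal numbers, as the significand \<open>m\<close> need not be normalized.
\<close>

definition binary_format :: "nat \<Rightarrow> int \<Rightarrow> bool" where
  "binary_format p emax \<longleftrightarrow> 2 \<le> p \<and> 1 \<le> emax"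

definition fp_numbers :: "nat \<Rightarrow> int \<Rightarrow> real set" where
  "fp_numbers p emax =
     {real_of_int m * 2 powi (e - int p + 1) | m e. \<bar>m\<bar> < 2 ^ p \<and> 1 - emax \<le> e \<and> e \<le> emax}"

definition min_normal :: "int \<Rightarrow> real" where
  "min_normal emax = 2 powi (1 - emax)"

definition max_finite :: "nat \<Rightarrow> int \<Rightarrow> real" where
  "max_finite p emax = 2 powi emax * (2 - 2 powi (1 - int p))"

definition within_exponent_range :: "nat \<Rightarrow> int \<Rightarrow> real \<Rightarrow> bool" where
  "within_exponent_range p emax x \<longleftrightarrow> min_normal emax \<le> x \<and> x \<le> max_finite p emax"

text \<open>
  All exceptional results (infinities and NaNs, hence in particular overflow, division by zero
  and the square root of a negative number) are merged into one value, which every operation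
  propagates.  IEEE 754 sometimes returns a finite number for an infinite operand; here such a
  computation counts as failed.
\<close>

datatype fpval = Finite real | Exceptional

text \<open>
  By IEEE 754, rounding to nearest overflows exactly from half a unit in the last place above
  the largest finite number.  The rule for breaking ties is left open.
\<close>

definition overflow_threshold :: "nat \<Rightarrow> int \<Rightarrow> real" where
  "overflow_threshold p emax = 2 powi emax * (2 - 2 powi (- int p))"

definition round_to_nearest :: "nat \<Rightarrow> int \<Rightarrow> (real \<Rightarrow> fpval) \<Rightarrow> bool" where
  "round_to_nearest p emax fl \<longleftrightarrow>
     (\<forall>x. if \<bar>x\<bar> < overflow_threshold p emax
          then \<exists>y \<in> fp_numbers p emax. fl x = Finite y \<and>
                 (\<forall>z \<in> fp_numbers p emax. \<bar>y - x\<bar> \<le> \<bar>z - x\<bar>)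
          else fl x = Exceptional)"

fun fp_binop :: "(real \<Rightarrow> fpval) \<Rightarrow> (real \<Rightarrow> real \<Rightarrow> real) \<Rightarrow> fpval \<Rightarrow> fpval \<Rightarrow> fpval" where
  "fp_binop fl f (Finite a) (Finite b) = fl (f a b)"
| "fp_binop fl f _ _ = Exceptional"

definition fp_div :: "(real \<Rightarrow> fpval) \<Rightarrow> fpval \<Rightarrow> fpval \<Rightarrow> fpval" where
  "fp_div fl a b = (if b = Finite 0 then Exceptional else fp_binop fl (/) a b)"

fun fp_sqrt :: "(real \<Rightarrow> fpval) \<Rightarrow> fpval \<Rightarrow> fpval" where
  "fp_sqrt fl (Finite a) = (if a < 0 then Exceptional else fl (sqrt a))"
| "fp_sqrt fl Exceptional = Exceptional"

text \<open>
  \<open>fp_sum fl M s\<close>: the value \<open>s\<close> is a result of summing the multiset \<open>M\<close> of floating point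
  numbers in some order and with some bracketing (possibly starting from zero accumulators).
  A summation procedure may use any of them.
\<close>

inductive fp_sum :: "(real \<Rightarrow> fpval) \<Rightarrow> fpval multiset \<Rightarrow> fpval \<Rightarrow> bool" for fl where
  fp_sum_empty: "fp_sum fl {#} (Finite 0)"
| fp_sum_single: "fp_sum fl {#a#} a"
| fp_sum_add: "fp_sum fl M a \<Longrightarrow> fp_sum fl N b \<Longrightarrow> fp_sum fl (M + N) (fp_binop fl (+) a b)"

definition fp_summation :: "(real \<Rightarrow> fpval) \<Rightarrow> (fpval list \<Rightarrow> fpval) \<Rightarrow> bool" where
  "fp_summation fl S \<longleftrightarrow> (\<forall>xs. fp_sum fl (mset xs) (S xs))"

section \<open>The Arnoldi algorithm over an arbitrary arithmetic\<close>

record 'a arith =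
  ar_zero :: 'a
  ar_sum :: "'a list \<Rightarrow> 'a"
  ar_sub :: "'a \<Rightarrow> 'a \<Rightarrow> 'a"
  ar_mul :: "'a \<Rightarrow> 'a \<Rightarrow> 'a"
  ar_div :: "'a \<Rightarrow> 'a \<Rightarrow> 'a"
  ar_sqrt :: "'a \<Rightarrow> 'a"

definition exact_arith :: "real arith" where
  "exact_arith = \<lparr> ar_zero = 0, ar_sum = sum_list, ar_sub = (-), ar_mul = (*),
                   ar_div = (/), ar_sqrt = sqrt \<rparr>"

definition fp_arith :: "(real \<Rightarrow> fpval) \<Rightarrow> (fpval list \<Rightarrow> fpval) \<Rightarrow> fpval arith" where
  "fp_arith fl S = \<lparr> ar_zero = Finite 0, ar_sum = S, ar_sub = fp_binop fl (-),
                     ar_mul = fp_binop fl (*), ar_div = fp_div fl, ar_sqrt = fp_sqrt fl \<rparr>"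

definition ar_inner :: "'a arith \<Rightarrow> 'a vec \<Rightarrow> 'a vec \<Rightarrow> 'a" where
  "ar_inner ar x y = ar_sum ar (map (\<lambda>k. ar_mul ar (x $ k) (y $ k)) [0..<dim_vec y])"

definition ar_norm :: "'a arith \<Rightarrow> 'a vec \<Rightarrow> 'a" where
  "ar_norm ar x = ar_sqrt ar (ar_sum ar (map (\<lambda>k. ar_mul ar (x $ k) (x $ k)) [0..<dim_vec x]))"

definition ar_mult_mat_vec :: "'a arith \<Rightarrow> 'a mat \<Rightarrow> 'a vec \<Rightarrow> 'a vec" where
  "ar_mult_mat_vec ar A x = vec (dim_row A) (\<lambda>k. ar_inner ar (row A k) x)"

definition ar_sub_scaled :: "'a arith \<Rightarrow> 'a vec \<Rightarrow> 'a \<Rightarrow> 'a vec \<Rightarrow> 'a vec" where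
  "ar_sub_scaled ar w h v = vec (dim_vec w) (\<lambda>k. ar_sub ar (w $ k) (ar_mul ar h (v $ k)))"

definition ar_div_vec :: "'a arith \<Rightarrow> 'a vec \<Rightarrow> 'a \<Rightarrow> 'a vec" where
  "ar_div_vec ar w h = vec (dim_vec w) (\<lambda>k. ar_div ar (w $ k) h)"

text \<open>
  The algorithm is represented by the chronological list of its assignments: \<open>Basis j v\<close> assigns
  \<open>v\<close> to \<open>v\<^sub>j\<close>, \<open>Work w\<close> assigns \<open>w\<close> to the working vector, and \<open>Coeff i j h\<close> assigns \<open>h\<close>
  to \<open>h\<^sub>i\<^sub>,\<^sub>j\<close>.  The type parameters are the types of vectors and of scalars.  Indices start at 1.
\<close>

datatype ('v, 'a) assignment = Basis nat 'v | Work 'v | Coeff nat nat 'a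

text \<open>The inner loop, over the basis vectors \<open>v\<^sub>i, \<dots>, v\<^sub>j\<close>; it also returns the final \<open>w\<close>.\<close>
fun orthogonalize :: "'a arith \<Rightarrow> nat \<Rightarrow> nat \<Rightarrow> 'a vec list \<Rightarrow> 'a vec
    \<Rightarrow> ('a vec, 'a) assignment list \<times> 'a vec" where
  "orthogonalize ar j i [] w = ([], w)"
| "orthogonalize ar j i (v # vs) w =
    (let h = ar_inner ar v w;
         w' = ar_sub_scaled ar w h v;
         (tr, w'') = orthogonalize ar j (i + 1) vs w'
     in (Coeff i j h # Work w' # tr, w''))"

text \<open>
  The outer loop: the argument of type \<^typ>\<open>nat\<close> is the number of iterations left, and the list
  holds \<open>v\<^sub>1, \<dots>, v\<^sub>j\<close>.
\<close>
primrec arnoldi_iterate :: "'a arith \<Rightarrow> 'a mat \<Rightarrow> nat \<Rightarrow> 'a vec list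
    \<Rightarrow> ('a vec, 'a) assignment list" where
  "arnoldi_iterate ar A 0 vs = []"
| "arnoldi_iterate ar A (Suc m) vs =
    (let j = length vs;
         w = ar_mult_mat_vec ar A (last vs);
         (tr, w') = orthogonalize ar j 1 vs w;
         h = ar_norm ar w'
     in Work w # tr @ Coeff (j + 1) j h #
        (if h = ar_zero ar then []
         else let v' = ar_div_vec ar w' h
              in Basis (j + 1) v' # arnoldi_iterate ar A m (vs @ [v'])))"

definition arnoldi :: "'a arith \<Rightarrow> 'a mat \<Rightarrow> 'a vec \<Rightarrow> ('a vec, 'a) assignment list" where
  "arnoldi ar A v =
    (let v1 = ar_div_vec ar v (ar_norm ar v)
     in Basis 1 v1 # arnoldi_iterate ar A (dim_row A) [v1])"

definition coeffs_of :: "('v, 'a) assignment list \<Rightarrow> nat \<times> nat \<Rightarrow> 'a option" where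
  "coeffs_of tr = map_of [((i, j), h). Coeff i j h \<leftarrow> tr]"

text \<open>
  The matrix \<open>H\<^sub>k\<close> (matrix indices start at 0); it is only defined if the algorithm has assigned
  all the coefficients involved.
\<close>
definition arnoldi_hessenberg :: "'a arith \<Rightarrow> nat \<Rightarrow> ('v, 'a) assignment list \<Rightarrow> 'a mat option" where
  "arnoldi_hessenberg ar k tr =
    (if \<forall>j \<in> {1..k}. \<forall>i \<in> {1..min k (j + 1)}. (i, j) \<in> dom (coeffs_of tr)
     then Some (mat k k (\<lambda>(i, j). if i \<le> j + 1 then the (coeffs_of tr (i + 1, j + 1))
                                   else ar_zero ar))
     else None)"

text \<open>
  Data given in exact arithmetic enter the floating point algorithm through \<^const>\<open>Finite\<close>.  The
  floating point computation is exact if it performs the same sequence of assignments, with the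
  same values, as the computation in exact arithmetic.
\<close>
definition arnoldi_fp :: "(real \<Rightarrow> fpval) \<Rightarrow> (fpval list \<Rightarrow> fpval) \<Rightarrow> real mat \<Rightarrow> real vec
    \<Rightarrow> (fpval vec, fpval) assignment list" where
  "arnoldi_fp fl S A v = arnoldi (fp_arith fl S) (map_mat Finite A) (map_vec Finite v)"

definition arnoldi_computes_exactly :: "(real \<Rightarrow> fpval) \<Rightarrow> (fpval list \<Rightarrow> fpval) \<Rightarrow> real mat
    \<Rightarrow> real vec \<Rightarrow> bool" where
  "arnoldi_computes_exactly fl S A v \<longleftrightarrow>
     arnoldi_fp fl S A v =
     map (map_assignment (map_vec Finite) Finite) (arnoldi exact_arith A v)"

section \<open>Matrices\<close>

definition signed_permutation_mat :: "nat \<Rightarrow> real mat \<Rightarrow> bool" where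
  "signed_permutation_mat n P \<longleftrightarrow>
     (\<exists>\<pi> s. \<pi> permutes {..<n} \<and> (\<forall>j<n. s j \<in> {1, -1}) \<and>
            P = mat n n (\<lambda>(i, j). if i = \<pi> j then s j else 0))"

definition upper_hessenberg :: "'a::zero mat \<Rightarrow> bool" where
  "upper_hessenberg H \<longleftrightarrow> (\<forall>i < dim_row H. \<forall>j < dim_col H. j + 1 < i \<longrightarrow> H $$ (i, j) = 0)"

end

theory Submission
  imports Defs
begin

text \<open>
  The conjugated matrix \<open>A = P H P\<^sup>T\<close> is built so that the \<open>j\<close>-th Arnoldi vector is the \<open>j\<close>-th
  column of \<open>P\<close>, a coordinate vector up to sign.  Hence every inner product \<open>v\<^sub>i\<^sup>T w\<close>, and every
  entry of \<open>A v\<^sub>j\<close>, is a sum with at most one nonzero term, and this term is an entry of \<open>H\<close> up to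
  sign; subtracting \<open>h\<^sub>i\<^sub>j v\<^sub>i\<close> from \<open>w\<close> replaces one entry of \<open>w\<close> by \<open>0\<close> and leaves the others
  alone; and normalization divides \<open>h\<close> or \<open>-h\<close> by \<open>h\<close>.  All these results are floating point
  numbers, and rounding fixes those, in whatever order a sum is evaluated.

  The only operation that does round is the norm: the floating point square of \<open>h\<close> need not be
  \<open>h\<^sup>2\<close>.  But in radix 2 the square root undoes the error (\<open>fl_sqrt_fl_square\<close>).  If
  \<open>2^E < h < 2^(E+1)\<close>, all other floating point numbers are at least one unit \<open>2^(E-p+1)\<close> away
  from \<open>h\<close>.  The square, which is below \<open>2^(2E+2)\<close>, is rounded to some \<open>s\<close> with
  \<open>\<bar>s - h\<^sup>2\<bar> \<le> 2^(2E+1-p)\<close>, and dividing by \<open>sqrt s + h > 2^(E+1)\<close> shows that \<open>sqrt s\<close> is less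
  than half a unit from \<open>h\<close>.  So \<open>h\<close> is the nearest floating point number to \<open>sqrt s\<close>, and no
  tie can occur.  If \<open>h\<close> is a power of two, its square is exact.  The range condition on \<open>h\<^sup>2\<close>
  excludes overflow and makes the error bound on \<open>s\<close> available.

  What the algorithm needs from its arithmetic is collected in the locale \<open>sparse_exact_arith\<close>, of
  which both exact and floating point arithmetic are instances.  In every instance the run of the
  algorithm is the image of one explicit list of assignments (\<open>arnoldi_conjugate\<close>), so the two runs
  agree, and the entries of \<open>H\<close> can be read off that list.
\<close>

section \<open>Binary floating point numbers and rounding\<close>

lemma binary_exponent_exists:
  fixes x :: real
  assumes "x > 0"
  obtains E :: int where "2 powi E \<le> x" "x < 2 powi (E + 1)"
proof
  show "2 powi \<lfloor>log 2 x\<rfloor> \<le> x"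
    using assms floor_log_eq_powr_iff[of x 2 "\<lfloor>log 2 x\<rfloor>"] by (simp add: powr_real_of_int')
  show "x < 2 powi (\<lfloor>log 2 x\<rfloor> + 1)"
    using assms floor_log_eq_powr_iff[of x 2 "\<lfloor>log 2 x\<rfloor>"]
    by (simp flip: powr_real_of_int')
qed

lemma two_powi_less_iff: "(2::real) powi a < 2 powi b \<longleftrightarrow> a < b"
  by (metis linorder_not_less not_le one_less_numeral_iff order_less_imp_le power_int_increasing
      power_int_strict_increasing semiring_norm(76) numeral_One one_le_numeral)

lemma two_powi_le_iff: "(2::real) powi a \<le> 2 powi b \<longleftrightarrow> a \<le> b"
  using two_powi_less_iff[of b a] by linarith

lemma two_powi_eq_int_mult:
  assumes "a \<le> b"
  shows "\<exists>k::int. (2::real) powi b = of_int k * 2 powi a"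
proof
  show "(2::real) powi b = of_int (2 ^ nat (b - a)) * 2 powi a"
    using assms power_int_add[of "2::real" "b - a" a] by (simp add: power_int_def)
qed

lemma two_powi_in_fp_numbers:
  assumes "p \<ge> 1" "1 - emax \<le> c" "c \<le> emax"
  shows "2 powi c \<in> fp_numbers p emax"
proof -
  have "(2::real) powi c = 2 powi (int (p - 1)) * 2 powi (c - int p + 1)"
    using assms by (simp flip: power_int_add add: of_nat_diff)
  hence "(2::real) powi c = real_of_int (2 ^ (p - 1)) * 2 powi (c - int p + 1)" by simp
  moreover have "\<bar>2 ^ (p - 1) :: int\<bar> < 2 ^ p" using assms by simp
  ultimately show ?thesis using assms unfolding fp_numbers_def by blast
qed

lemma fp_numbers_uminus: "x \<in> fp_numbers p emax \<Longrightarrow> - x \<in> fp_numbers p emax"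
  unfolding fp_numbers_def by (force intro: exI[of _ "- _"])

lemma zero_in_fp_numbers: "emax \<ge> 1 \<Longrightarrow> 0 \<in> fp_numbers p emax"
  unfolding fp_numbers_def by (auto intro!: exI[of _ 0])

lemma max_finite_less_threshold: "max_finite p emax < overflow_threshold p emax"
  unfolding max_finite_def overflow_threshold_def by (simp add: two_powi_less_iff)

lemma max_finite_eq: "max_finite p emax = (2 ^ p - 1) * 2 powi (emax - int p + 1)"
proof -
  have "(2::real) powi emax * 2 = 2 ^ p * 2 powi (emax - int p + 1)"
    using power_int_add[of "2::real" "int p" "emax - int p + 1"] by (simp add: power_int_add)
  moreover have "(2::real) powi emax * 2 powi (1 - int p) = 2 powi (emax - int p + 1)"
    by (simp flip: power_int_add add: algebra_simps)
  ultimately show ?thesis unfolding max_finite_def by (simp add: algebra_simps)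
qed

lemma fp_numbers_abs_le_max_finite:
  assumes "x \<in> fp_numbers p emax"
  shows "\<bar>x\<bar> \<le> max_finite p emax"
proof -
  obtain m e where x: "x = real_of_int m * 2 powi (e - int p + 1)" and m: "\<bar>m\<bar> < 2 ^ p"
    and e: "e \<le> emax"
    using assms unfolding fp_numbers_def by blast
  have "\<bar>m\<bar> \<le> 2 ^ p - 1" using m by simp
  hence "real_of_int \<bar>m\<bar> \<le> real_of_int (2 ^ p - 1)" by (simp only: of_int_le_iff)
  hence "\<bar>x\<bar> \<le> (2 ^ p - 1) * 2 powi (e - int p + 1)"
    unfolding x by (simp add: abs_mult)
  also have "\<dots> \<le> (2 ^ p - 1) * 2 powi (emax - int p + 1)"
    using e by (intro mult_left_mono) (simp_all add: two_powi_le_iff)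
  finally show ?thesis unfolding max_finite_eq .
qed

text \<open>
  A number of magnitude at least \<open>2\<^sup>E\<close> must be represented with exponent at least \<open>E\<close>, because the
  significand has only \<open>p\<close> bits.  Stating it this way avoids normalizing representations.
\<close>
lemma fp_numbers_int_mult_ulp:
  assumes z: "z \<in> fp_numbers p emax" and E: "2 powi E \<le> \<bar>z\<bar>"
  shows "\<exists>k::int. z = of_int k * 2 powi (E - int p + 1)"
proof -
  obtain m e where x: "z = real_of_int m * 2 powi (e - int p + 1)" and m: "\<bar>m\<bar> < 2 ^ p"
    using z unfolding fp_numbers_def by blast
  have "real_of_int \<bar>m\<bar> < real_of_int (2 ^ p)" using m by (simp only: of_int_less_iff)
  hence "\<bar>z\<bar> < 2 ^ p * 2 powi (e - int p + 1)"
    unfolding x by (simp add: abs_mult)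
  also have "\<dots> = 2 powi (e + 1)"
    using power_int_add[of "2::real" "int p" "e - int p + 1"] by simp
  finally have "(2::real) powi E < 2 powi (e + 1)" using E by simp
  hence "E - int p + 1 \<le> e - int p + 1" by (simp add: two_powi_less_iff)
  then obtain k :: int where "(2::real) powi (e - int p + 1) = of_int k * 2 powi (E - int p + 1)"
    using two_powi_eq_int_mult by blast
  hence "z = of_int (m * k) * 2 powi (E - int p + 1)" unfolding x by simp
  thus ?thesis by blast
qed

lemma int_mult_gap:
  fixes u :: real
  assumes "a = of_int k * u" "b = of_int l * u" "a < b" "u > 0"
  shows "u \<le> b - a"
proof -
  have "k < l" using assms by (simp)
  hence "1 \<le> l - k" by simp
  hence "1 \<le> real_of_int (l - k)" by linarith
  hence "1 * u \<le> real_of_int (l - k) * u" using assms by (intro mult_right_mono) auto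
  thus ?thesis using assms by (simp add: algebra_simps)
qed

text \<open>
  The strict inequality \<open>2 powi E < h\<close> matters: just below a power of two the spacing is halved.
  Above it, \<open>h\<close> and every number from \<open>2 powi E\<close> on are multiples of the unit; a smaller number is even
  farther from \<open>h\<close> than \<open>2 powi E\<close> is.
\<close>
lemma fp_numbers_gap:
  assumes p: "p \<ge> 1" and h: "h \<in> fp_numbers p emax" and E: "2 powi E < h"
    and z: "z \<in> fp_numbers p emax" and ne: "z \<noteq> h"
  shows "2 powi (E - int p + 1) \<le> \<bar>z - h\<bar>"
proof -
  let ?u = "2 powi (E - int p + 1) :: real"
  have u: "?u > 0" by simp
  have "2 powi E \<le> \<bar>h\<bar>" using E by simp
  then obtain k where k: "h = of_int k * ?u" using fp_numbers_int_mult_ulp[OF h] by blast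
  show ?thesis
  proof (cases "2 powi E \<le> z")
    case True
    then obtain l where l: "z = of_int l * ?u" using fp_numbers_int_mult_ulp[OF z, of E] by force
    show ?thesis using int_mult_gap[OF k l _ u] int_mult_gap[OF l k _ u] ne by linarith
  next
    case False
    obtain l :: int where l: "(2::real) powi E = of_int l * ?u"
      using two_powi_eq_int_mult[of "E - int p + 1" E] p by force
    show ?thesis using int_mult_gap[OF l k E u] False by linarith
  qed
qed

lemma fl_nearest:
  assumes "round_to_nearest p emax fl" "\<bar>x\<bar> < overflow_threshold p emax"
  obtains y where "y \<in> fp_numbers p emax" "fl x = Finite y"
    "\<And>z. z \<in> fp_numbers p emax \<Longrightarrow> \<bar>y - x\<bar> \<le> \<bar>z - x\<bar>"
  using assms unfolding round_to_nearest_def by meson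

lemma fl_fp_number:
  assumes "round_to_nearest p emax fl" "x \<in> fp_numbers p emax"
  shows "fl x = Finite x"
proof -
  have "\<bar>x\<bar> < overflow_threshold p emax"
    using fp_numbers_abs_le_max_finite[OF assms(2)] max_finite_less_threshold[of p emax] by linarith
  then obtain y where "fl x = Finite y" "\<And>z. z \<in> fp_numbers p emax \<Longrightarrow> \<bar>y - x\<bar> \<le> \<bar>z - x\<bar>"
    using fl_nearest[OF assms(1)] by blast
  thus ?thesis using assms(2) by force
qed

lemma binary_exponent_in_range:
  assumes "within_exponent_range p emax x" "2 powi c \<le> x" "x < 2 powi (c + 1)"
  shows "1 - emax \<le> c" "c \<le> emax"
proof -
  have "max_finite p emax < 2 powi (emax + 1)"
    unfolding max_finite_def by (simp add: power_int_add)
  hence "(2::real) powi (1 - emax) < 2 powi (c + 1)" "(2::real) powi c < 2 powi (emax + 1)"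
    using assms unfolding within_exponent_range_def min_normal_def by linarith+
  thus "1 - emax \<le> c" "c \<le> emax" by (simp_all add: two_powi_less_iff)
qed

text \<open>
  Rounding the significand to an integer does it, unless this gives \<open>2 ^ p\<close>; then the result is
  the power of two \<open>2 powi (c + 1)\<close>.  In the last binade this cannot happen, because a number that
  close to its top exceeds the largest finite one.
\<close>
lemma fp_number_within_half_ulp:
  assumes p: "p \<ge> 1" and rng: "within_exponent_range p emax x"
    and c: "2 powi c \<le> x" "x < 2 powi (c + 1)"
  shows "\<exists>z \<in> fp_numbers p emax. \<bar>z - x\<bar> \<le> 2 powi (c - int p)"
proof -
  let ?u = "2 powi (c - int p + 1) :: real"
  have u: "?u > 0" by simp
  have half: "?u / 2 = 2 powi (c - int p)" by (simp add: power_int_add)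
  have c1: "1 - emax \<le> c" and c2: "c \<le> emax"
    using binary_exponent_in_range[OF rng c] by auto
  define k where "k = round (x / ?u)"
  have top: "2 ^ p * ?u = 2 powi (c + 1)"
    using power_int_add[of "2::real" "int p" "c - int p + 1"] by simp
  have "\<bar>of_int k - x / ?u\<bar> \<le> 1 / 2" unfolding k_def by (rule of_int_round_abs_le)
  hence "\<bar>of_int k - x / ?u\<bar> * ?u \<le> 1 / 2 * ?u" using u by (intro mult_right_mono) auto
  moreover have "\<bar>of_int k - x / ?u\<bar> * ?u = \<bar>of_int k * ?u - x\<bar>"
    using u by (simp add: abs_mult_pos' algebra_simps flip: abs_mult_pos)
  ultimately have near: "\<bar>of_int k * ?u - x\<bar> \<le> 2 powi (c - int p)" using half by simp
  have "0 < x" using c(1) less_le_trans[of 0 "2 powi c" x] by simp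
  hence k0: "0 \<le> k" unfolding k_def using round_mono[of 0 "x / ?u"] by simp
  have "x / ?u \<le> of_int (2 ^ p)" using c(2) top u by (simp add: divide_le_eq)
  hence kp: "k \<le> 2 ^ p" unfolding k_def using round_mono[of "x / ?u" "of_int (2 ^ p)"]
    by (simp only: round_of_int)
  have "of_int k * ?u \<in> fp_numbers p emax"
  proof (cases "k < 2 ^ p")
    case True
    thus ?thesis using k0 c1 c2 unfolding fp_numbers_def by force
  next
    case False
    hence k: "k = 2 ^ p" using kp by simp
    \<comment> \<open>In the last binade the upper end of the range caps the significand at \<open>2 ^ p - 1\<close>.\<close>
    have "c \<noteq> emax"
    proof
      assume "c = emax"
      hence "x \<le> (2 ^ p - 1) * ?u" using rng unfolding within_exponent_range_def max_finite_eq by simp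
      hence "x / ?u \<le> of_int (2 ^ p - 1)" using u by (simp add: divide_le_eq)
      hence "k \<le> 2 ^ p - 1" unfolding k_def using round_mono[of "x / ?u" "of_int (2 ^ p - 1)"]
        by (simp only: round_of_int)
      thus False using k by simp
    qed
    hence "2 powi (c + 1) \<in> fp_numbers p emax" using p c1 c2 by (intro two_powi_in_fp_numbers) auto
    thus ?thesis using top k by simp
  qed
  thus ?thesis using near by blast
qed

text \<open>
  The error of the root is \<open>sqrt s - h = (s - h\<^sup>2) / (sqrt s + h)\<close>.  The numerator is at most
  \<open>2 powi (2 * E + 1 - int p)\<close> in either of the two binades that can contain \<open>h\<^sup>2\<close>, and the denominator
  exceeds \<open>2 powi (E + 1)\<close>; so the error is less than half of the gap around \<open>h\<close>.
\<close>
lemma fl_sqrt_fl_square: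
  assumes fmt: "binary_format p emax" and fl: "round_to_nearest p emax fl"
    and h: "h \<in> fp_numbers p emax" "h > 0" and rng: "within_exponent_range p emax (h\<^sup>2)"
  shows "\<exists>s \<in> fp_numbers p emax. s \<ge> 0 \<and> fl (h\<^sup>2) = Finite s \<and> fl (sqrt s) = Finite h"
proof -
  have p: "p \<ge> 1" and emax: "emax \<ge> 1" using fmt unfolding binary_format_def by auto
  obtain E where E: "2 powi E \<le> h" "h < 2 powi (E + 1)" using binary_exponent_exists[OF h(2)] .
  have sq: "(2 powi E :: real)\<^sup>2 = 2 powi (2 * E)"
    by (simp add: power2_eq_square flip: power_int_add mult_2)
  have "0 < h\<^sup>2" using h(2) by simp
  then obtain c where c: "2 powi c \<le> h\<^sup>2" "h\<^sup>2 < 2 powi (c + 1)"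
    using binary_exponent_exists by blast
  have hl: "2 powi (2 * E) \<le> h\<^sup>2" using E(1) power_mono[of "2 powi E" h 2] sq by simp
  have "h\<^sup>2 < (2 powi (E + 1))\<^sup>2" using E(2) h(2) by (intro power_strict_mono) auto
  hence hu: "h\<^sup>2 < 2 powi (2 * E + 2)"
    by (simp add: power2_eq_square algebra_simps flip: power_int_add)
  have cE: "2 * E \<le> c" "c \<le> 2 * E + 1"
  proof -
    have "(2::real) powi (2 * E) < 2 powi (c + 1)" "(2::real) powi c < 2 powi (2 * E + 2)"
      using hl hu c by linarith+
    thus "2 * E \<le> c" "c \<le> 2 * E + 1" by (simp_all add: two_powi_less_iff)
  qed
  have "h\<^sup>2 \<le> max_finite p emax" using rng unfolding within_exponent_range_def by simp
  hence "\<bar>h\<^sup>2\<bar> < overflow_threshold p emax" using max_finite_less_threshold[of p emax] by simp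
  then obtain s where s: "s \<in> fp_numbers p emax" "fl (h\<^sup>2) = Finite s"
    and nearest: "\<And>z. z \<in> fp_numbers p emax \<Longrightarrow> \<bar>s - h\<^sup>2\<bar> \<le> \<bar>z - h\<^sup>2\<bar>"
    using fl_nearest[OF fl] by blast
  have "2 powi c \<in> fp_numbers p emax"
    using binary_exponent_in_range[OF rng c] p by (intro two_powi_in_fp_numbers) auto
  from nearest[OF this] have sc: "2 powi c \<le> s" using c(1) by linarith
  hence s0: "s \<ge> 0" using less_le_trans[of 0 "2 powi c" s] by simp
  \<comment> \<open>The case of a power of two is apart since the gap below \<open>h\<close> is only half a unit there.\<close>
  have "fl (sqrt s) = Finite h"
  proof (cases "h = 2 powi E")
    case True
    hence "c = 2 * E" using c cE sq two_powi_le_iff[of c "2 * E"] by simp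
    hence "h\<^sup>2 \<in> fp_numbers p emax" using \<open>2 powi c \<in> _\<close> True sq by simp
    hence "s = h\<^sup>2" using nearest[of "h\<^sup>2"] by simp
    thus ?thesis using h fl_fp_number[OF fl h(1)] by simp
  next
    case False
    hence Eh: "2 powi E < h" using E(1) by simp
    obtain z where z: "z \<in> fp_numbers p emax" "\<bar>z - h\<^sup>2\<bar> \<le> 2 powi (c - int p)"
      using fp_number_within_half_ulp[OF p rng c] by blast
    have "\<bar>s - h\<^sup>2\<bar> \<le> 2 powi (c - int p)" using nearest[OF z(1)] z(2) by linarith
    also have "\<dots> \<le> 2 powi (2 * E + 1 - int p)" using cE by (simp add: two_powi_le_iff)
    also have "\<dots> = 2 powi (E - int p) * 2 powi (E + 1)"
      by (simp add: algebra_simps flip: power_int_add)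
    finally have err: "\<bar>s - h\<^sup>2\<bar> \<le> 2 powi (E - int p) * 2 powi (E + 1)" .
    have "2 powi (2 * E) \<le> s" using cE(1) sc two_powi_le_iff[of "2 * E" c] by linarith
    hence "2 powi E \<le> sqrt s" by (metis real_le_rsqrt sq)
    hence "2 powi (E + 1) < sqrt s + h" using Eh by (simp add: power_int_add)
    have prod: "\<bar>sqrt s - h\<bar> * (sqrt s + h) = \<bar>s - h\<^sup>2\<bar>"
    proof -
      have "(sqrt s - h) * (sqrt s + h) = s - h\<^sup>2"
        using s0 by (simp add: algebra_simps power2_eq_square)
      moreover have "\<bar>sqrt s + h\<bar> = sqrt s + h" using s0 h by simp
      ultimately show ?thesis by (metis abs_mult)
    qed
    have close: "\<bar>h - sqrt s\<bar> < 2 powi (E - int p)"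
    proof (rule ccontr)
      assume "\<not> ?thesis"
      hence "2 powi (E - int p) * 2 powi (E + 1) < \<bar>sqrt s - h\<bar> * (sqrt s + h)"
        using \<open>2 powi (E + 1) < sqrt s + h\<close>
        by (intro mult_le_less_imp_less) (auto simp: abs_minus_commute)
      thus False using err prod by simp
    qed
    have "sqrt s < overflow_threshold p emax"
    proof -
      have "1 \<le> max_finite p emax"
        using fp_numbers_abs_le_max_finite[OF two_powi_in_fp_numbers[of p emax 0]] p emax by simp
      moreover have "s \<le> max_finite p emax" using fp_numbers_abs_le_max_finite[OF s(1)] by simp
      moreover have "sqrt s \<le> max 1 s"
        using s0 real_le_lsqrt[of "max 1 s" s] by (auto simp: max_def power2_eq_square intro: real_le_lsqrt)
      ultimately show ?thesis using max_finite_less_threshold[of p emax] by simp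
    qed
    hence "\<bar>sqrt s\<bar> < overflow_threshold p emax" using s0 by simp
    then obtain y where y: "y \<in> fp_numbers p emax" "fl (sqrt s) = Finite y"
      "\<And>z. z \<in> fp_numbers p emax \<Longrightarrow> \<bar>y - sqrt s\<bar> \<le> \<bar>z - sqrt s\<bar>"
      using fl_nearest[OF fl] by blast
    have "\<bar>y - h\<bar> < 2 * 2 powi (E - int p)" using y(3)[OF h(1)] close by linarith
    also have "\<dots> = 2 powi (E - int p + 1)" by (simp add: power_int_add)
    finally have "y = h" using fp_numbers_gap[OF p h(1) Eh y(1)] by force
    thus ?thesis using y(2) by simp
  qed
  thus ?thesis using s s0 by blast
qed

section \<open>Sums of floating point numbers\<close>

text \<open>
  Every partial sum is again \<open>0\<close> or the single nonzero summand, so rounding fixes it, whatever the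
  order and the bracketing.
\<close>
lemma fp_sum_at_most_one_nonzero:
  assumes fl: "round_to_nearest p emax fl" and emax: "emax \<ge> 1" and "fp_sum fl M a"
  shows "(filter_mset (\<lambda>y. y \<noteq> Finite 0) M = {#} \<longrightarrow> a = Finite 0) \<and>
    (\<forall>x \<in> fp_numbers p emax. filter_mset (\<lambda>y. y \<noteq> Finite 0) M = {#Finite x#} \<longrightarrow> a = Finite x)"
  using assms(3)
proof induction
  case fp_sum_empty
  show ?case by simp
next
  case (fp_sum_single a)
  show ?case by auto
next
  case (fp_sum_add M a N b)
  have "fl 0 = Finite 0" using fl_fp_number[OF fl zero_in_fp_numbers[OF emax]] .
  moreover have "fl x = Finite x" if "x \<in> fp_numbers p emax" for x
    using fl_fp_number[OF fl that] .
  ultimately show ?case using fp_sum_add.IH by (auto simp: union_is_single)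
qed

lemma fp_summation_single:
  assumes fl: "round_to_nearest p emax fl" and emax: "emax \<ge> 1" and S: "fp_summation fl S"
    and x: "x \<in> fp_numbers p emax" and i: "i < m"
  shows "S (map (\<lambda>k. Finite (if k = i then x else 0)) [0..<m]) = Finite x"
proof -
  let ?xs = "map (\<lambda>k. Finite (if k = i then x else 0)) [0..<m]"
  have upt: "[0..<m] = [0..<i] @ i # [Suc i..<m]"
    using i by (metis upt_add_eq_append upt_conv_Cons le0 less_imp_le le_add_diff_inverse)
  have "map (\<lambda>k. Finite (if k = i then x else 0)) [0..<i] = replicate i (Finite 0)"
    "map (\<lambda>k. Finite (if k = i then x else 0)) [Suc i..<m] = replicate (m - Suc i) (Finite 0)"
    by (auto intro!: nth_equalityI)
  hence xs: "?xs = replicate i (Finite 0) @ Finite x # replicate (m - Suc i) (Finite 0)"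
    unfolding upt by simp
  have "filter_mset (\<lambda>y. y \<noteq> Finite 0) (mset ?xs) = (if x = 0 then {#} else {#Finite x#})"
    unfolding xs by (auto simp: filter_mset_eq_conv)
  moreover have "fp_sum fl (mset ?xs) (S ?xs)" using S unfolding fp_summation_def by blast
  note fp_sum_at_most_one_nonzero[OF fl emax this]
  ultimately show ?thesis using x by (cases "x = 0") metis+
qed

section \<open>Arithmetics that are exact on sparse vectors\<close>

text \<open>
  The properties of an arithmetic that a run along signed coordinate vectors relies on.  The
  function \<open>emb\<close> represents real numbers in the arithmetic, \<open>F\<close> contains the numbers that are
  represented faithfully, and \<open>N\<close> the numbers that may occur as nonzero norms.  The norm is
  axiomatized as a whole, since the squares inside it need not be represented exactly.
\<close>
locale sparse_exact_arith =
  fixes ar :: "'a arith" and emb :: "real \<Rightarrow> 'a" and F N :: "real set"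
  assumes zero_in_F: "0 \<in> F"
    and uminus_in_F: "x \<in> F \<Longrightarrow> - x \<in> F"
    and emb_zero: "ar_zero ar = emb 0"
    and emb_nonzero: "h \<in> N \<Longrightarrow> emb h \<noteq> emb 0"
    and sum_single: "x \<in> F \<Longrightarrow> i < m \<Longrightarrow>
      ar_sum ar (map (\<lambda>k. emb (if k = i then x else 0)) [0..<m]) = emb x"
    and mul_sign_right: "x \<in> F \<Longrightarrow> t \<in> {-1, 0, 1} \<Longrightarrow> ar_mul ar (emb x) (emb t) = emb (t * x)"
    and mul_sign_left: "x \<in> F \<Longrightarrow> t \<in> {-1, 0, 1} \<Longrightarrow> ar_mul ar (emb t) (emb x) = emb (t * x)"
    and sub_zero: "x \<in> F \<Longrightarrow> ar_sub ar (emb x) (emb 0) = emb x"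
    and sub_self: "x \<in> F \<Longrightarrow> ar_sub ar (emb x) (emb x) = emb 0"
    and div_pivot: "h \<in> N \<Longrightarrow> t \<in> {-1, 0, 1} \<Longrightarrow> ar_div ar (emb (t * h)) (emb h) = emb t"
    and norm_single: "h \<in> N \<Longrightarrow> t \<in> {-1, 1} \<Longrightarrow> i < m \<Longrightarrow>
      ar_norm ar (map_vec emb ((t * h) \<cdot>\<^sub>v unit_vec m i)) = emb h"
    and norm_zero: "ar_norm ar (map_vec emb (0\<^sub>v m)) = emb 0"
begin

lemma sign_mult_in_F: "x \<in> F \<Longrightarrow> t \<in> {-1, 0, 1} \<Longrightarrow> t * x \<in> F"
  using zero_in_F uminus_in_F by auto

lemma inner_sign_left:
  assumes "i < m" "t \<in> {-1, 1}" "\<And>k. k < m \<Longrightarrow> x $ k \<in> F" "x \<in> carrier_vec m"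
  shows "ar_inner ar (map_vec emb (t \<cdot>\<^sub>v unit_vec m i)) (map_vec emb x) = emb (t * x $ i)"
proof -
  have "map (\<lambda>k. ar_mul ar (map_vec emb (t \<cdot>\<^sub>v unit_vec m i) $ k) (map_vec emb x $ k)) [0..<m]
      = map (\<lambda>k. emb (if k = i then t * x $ i else 0)) [0..<m]"
    using assms by (auto simp: mul_sign_left)
  moreover have "t * x $ i \<in> F" using assms by (intro sign_mult_in_F) auto
  ultimately show ?thesis using assms(1,4) sum_single[of "t * x $ i" i m]
    by (simp add: ar_inner_def del: map_eq_conv)
qed

lemma inner_sign_right:
  assumes "i < m" "t \<in> {-1, 1}" "\<And>k. k < m \<Longrightarrow> x $ k \<in> F" "x \<in> carrier_vec m"
  shows "ar_inner ar (map_vec emb x) (map_vec emb (t \<cdot>\<^sub>v unit_vec m i)) = emb (t * x $ i)"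
proof -
  have "map (\<lambda>k. ar_mul ar (map_vec emb x $ k) (map_vec emb (t \<cdot>\<^sub>v unit_vec m i) $ k)) [0..<m]
      = map (\<lambda>k. emb (if k = i then t * x $ i else 0)) [0..<m]"
    using assms by (auto simp: mul_sign_right)
  moreover have "t * x $ i \<in> F" using assms by (intro sign_mult_in_F) auto
  ultimately show ?thesis using assms(1,4) sum_single[of "t * x $ i" i m]
    by (simp add: ar_inner_def del: map_eq_conv)
qed

lemma mult_mat_vec_sign:
  assumes "i < m" "t \<in> {-1, 1}" "elements_mat A \<subseteq> F" "A \<in> carrier_mat m m"
  shows "ar_mult_mat_vec ar (map_mat emb A) (map_vec emb (t \<cdot>\<^sub>v unit_vec m i))
    = map_vec emb (t \<cdot>\<^sub>v col A i)"
proof (rule eq_vecI)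
  fix k assume "k < dim_vec (map_vec emb (t \<cdot>\<^sub>v col A i))"
  hence k: "k < m" using assms by simp
  have "ar_inner ar (map_vec emb (row A k)) (map_vec emb (t \<cdot>\<^sub>v unit_vec m i))
      = emb (t * row A k $ i)"
    using assms k by (intro inner_sign_right) (auto intro: subsetD[OF assms(3) elements_matI[OF assms(4)]])
  moreover have "row (map_mat emb A) k = map_vec emb (row A k)" using assms k by auto
  ultimately show "ar_mult_mat_vec ar (map_mat emb A) (map_vec emb (t \<cdot>\<^sub>v unit_vec m i)) $ k
      = map_vec emb (t \<cdot>\<^sub>v col A i) $ k"
    using assms k by (simp add: ar_mult_mat_vec_def)
qed (use assms in \<open>auto simp: ar_mult_mat_vec_def\<close>)

lemma sub_scaled_sign:
  assumes "i < m" "t \<in> {-1, 1}" "\<And>k. k < m \<Longrightarrow> x $ k \<in> F" "x \<in> carrier_vec m"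
  shows "ar_sub_scaled ar (map_vec emb x) (emb (t * x $ i)) (map_vec emb (t \<cdot>\<^sub>v unit_vec m i))
    = map_vec emb (vec m (\<lambda>k. if k = i then 0 else x $ k))"
proof (rule eq_vecI)
  fix k assume "k < dim_vec (map_vec emb (vec m (\<lambda>k. if k = i then 0 else x $ k)))"
  hence k: "k < m" by simp
  have "t * x $ i \<in> F" using assms by (intro sign_mult_in_F) auto
  hence "ar_mul ar (emb (t * x $ i)) (emb t) = emb (t * (t * x $ i))"
    "ar_mul ar (emb (t * x $ i)) (emb 0) = emb (0 * (t * x $ i))"
    using mul_sign_right assms(2) by blast+
  moreover have "t * (t * x $ i) = x $ i" using assms(2) by auto
  ultimately show "ar_sub_scaled ar (map_vec emb x) (emb (t * x $ i))
      (map_vec emb (t \<cdot>\<^sub>v unit_vec m i)) $ k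
      = map_vec emb (vec m (\<lambda>k. if k = i then 0 else x $ k)) $ k"
    using assms k by (auto simp: ar_sub_scaled_def sub_zero sub_self)
qed (use assms in \<open>auto simp: ar_sub_scaled_def\<close>)

lemma div_vec_pivot:
  assumes "t \<in> {-1, 1}" "h \<in> N"
  shows "ar_div_vec ar (map_vec emb ((t * h) \<cdot>\<^sub>v unit_vec m i)) (emb h)
    = map_vec emb (t \<cdot>\<^sub>v unit_vec m i)"
  using div_pivot[OF assms(2), of t] div_pivot[OF assms(2), of 0] assms(1)
  by (auto simp: ar_div_vec_def unit_vec_def intro!: eq_vecI)

end

text \<open>
  Nothing is rounded here; \<open>N\<close> consists of the positive numbers since a norm is nonnegative and is
  divided by.
\<close>
lemma exact_arith_sparse:
  "sparse_exact_arith exact_arith id UNIV {0<..}"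
proof
  fix h t :: real and i m :: nat
  assume "h \<in> {0<..}" "t \<in> {-1, 1}" "i < m"
  have "map (\<lambda>k. ((t * h) \<cdot>\<^sub>v unit_vec m i) $ k * ((t * h) \<cdot>\<^sub>v unit_vec m i) $ k) [0..<m]
      = map (\<lambda>k. if k = i then h\<^sup>2 else 0) [0..<m]"
    using \<open>t \<in> {-1, 1}\<close> \<open>i < m\<close> by (auto simp: power2_eq_square)
  moreover have "sum_list \<dots> = h\<^sup>2"
    using \<open>i < m\<close> by (simp add: interv_sum_list_conv_sum_set_nat)
  moreover have "map_vec id w = w" for w :: "real vec" by auto
  ultimately show "ar_norm exact_arith (map_vec id ((t * h) \<cdot>\<^sub>v unit_vec m i)) = id h"
    using \<open>h \<in> {0<..}\<close> by (simp add: ar_norm_def exact_arith_def del: map_eq_conv index_smult_vec(1))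
next
  fix x :: real and i m :: nat
  assume "i < m"
  thus "ar_sum exact_arith (map (\<lambda>k. id (if k = i then x else 0)) [0..<m]) = id x"
    by (simp add: exact_arith_def interv_sum_list_conv_sum_set_nat)
next
  fix m :: nat
  show "ar_norm exact_arith (map_vec id (0\<^sub>v m)) = id 0"
    by (simp add: ar_norm_def exact_arith_def interv_sum_list_conv_sum_set_nat)
qed (auto simp: exact_arith_def)

text \<open>
  Apart from the squares inside a norm, all exact results are floating point numbers and thus fixed
  by rounding; the norm is covered by \<open>fl_sqrt_fl_square\<close>.
\<close>
lemma fp_arith_sparse:
  assumes fmt: "binary_format p emax" and fl: "round_to_nearest p emax fl"
    and S: "fp_summation fl S"
  shows "sparse_exact_arith (fp_arith fl S) Finite (fp_numbers p emax)
    {h \<in> fp_numbers p emax. h > 0 \<and> within_exponent_range p emax (h\<^sup>2)}"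
proof -
  have p: "p \<ge> 1" and emax: "emax \<ge> 1" using fmt unfolding binary_format_def by auto
  note zero = zero_in_fp_numbers[OF emax]
  have one: "1 \<in> fp_numbers p emax" using two_powi_in_fp_numbers[of p emax 0] p emax by simp
  have fix_fl: "fl x = Finite x" if "x \<in> fp_numbers p emax" for x
    using fl_fp_number[OF fl that] .
  have fl0: "fl 0 = Finite 0" using fix_fl[OF zero] .
  have sign: "t \<in> fp_numbers p emax" if "t \<in> {-1, 0, 1}" for t
    using that zero one fp_numbers_uminus[OF one] by auto
  have sgn_mult: "fl (t * x) = Finite (t * x)" if "x \<in> fp_numbers p emax" "t \<in> {-1, 0, 1}" for t x
    using that fix_fl fp_numbers_uminus zero by auto
  note summation = fp_summation_single[OF fl emax S]
  show ?thesis
  proof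
    fix h t :: real and i m :: nat
    assume h: "h \<in> {h \<in> fp_numbers p emax. h > 0 \<and> within_exponent_range p emax (h\<^sup>2)}"
      and t: "t \<in> {-1, 1}" and i: "i < m"
    \<comment> \<open>The number \<open>r\<close> is the rounded square; it need not be \<open>h\<^sup>2\<close>.\<close>
    obtain r where r: "r \<in> fp_numbers p emax" "r \<ge> 0" "fl (h\<^sup>2) = Finite r" "fl (sqrt r) = Finite h"
      using fl_sqrt_fl_square[OF fmt fl, of h] h by blast
    have "map (\<lambda>k. fp_binop fl (*) (map_vec Finite ((t * h) \<cdot>\<^sub>v unit_vec m i) $ k)
        (map_vec Finite ((t * h) \<cdot>\<^sub>v unit_vec m i) $ k)) [0..<m]
        = map (\<lambda>k. Finite (if k = i then r else 0)) [0..<m]"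
      using t i r(3) fl0 by (auto simp: power2_eq_square)
    thus "ar_norm (fp_arith fl S) (map_vec Finite ((t * h) \<cdot>\<^sub>v unit_vec m i)) = Finite h"
      using summation[OF r(1) i] r(2,4) by (simp add: ar_norm_def fp_arith_def del: map_eq_conv)
  next
    fix m :: nat
    \<comment> \<open>The vacuous conditional gives the list the form that the summation lemma expects.\<close>
    have sq: "map (\<lambda>k. fp_binop fl (*) (map_vec Finite (0\<^sub>v m) $ k) (map_vec Finite (0\<^sub>v m) $ k)) [0..<m]
        = map (\<lambda>k. Finite (if k = 0 then 0 else 0)) [0..<m]"
      using fl0 by auto
    have "S (map (\<lambda>k. Finite (if k = 0 then 0 else 0)) [0..<m]) = Finite 0"
    proof (cases "m = 0")
      case True
      have "fp_sum fl (mset []) (S [])" using S unfolding fp_summation_def by blast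
      from fp_sum_at_most_one_nonzero[OF fl emax this] show ?thesis using True by simp
    next
      case False
      thus ?thesis using summation[OF zero, of 0 m] by simp
    qed
    thus "ar_norm (fp_arith fl S) (map_vec Finite (0\<^sub>v m)) = Finite 0"
      using sq fl0 by (simp add: ar_norm_def fp_arith_def del: map_eq_conv)
  next
    fix h t :: real
    assume "h \<in> {h \<in> fp_numbers p emax. h > 0 \<and> within_exponent_range p emax (h\<^sup>2)}"
      and "t \<in> {-1, 0, 1}"
    thus "ar_div (fp_arith fl S) (Finite (t * h)) (Finite h) = Finite t"
      using fix_fl[OF sign] by (auto simp: fp_arith_def fp_div_def)
  next
    fix x t :: real
    assume "x \<in> fp_numbers p emax" "t \<in> {-1, 0, 1}"
    from sgn_mult[OF this]
    show "ar_mul (fp_arith fl S) (Finite x) (Finite t) = Finite (t * x)"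
      "ar_mul (fp_arith fl S) (Finite t) (Finite x) = Finite (t * x)"
      by (simp_all add: fp_arith_def mult.commute)
  next
    fix x :: real
    assume "x \<in> fp_numbers p emax"
    thus "- x \<in> fp_numbers p emax"
      "ar_sub (fp_arith fl S) (Finite x) (Finite 0) = Finite x"
      "ar_sub (fp_arith fl S) (Finite x) (Finite x) = Finite 0"
      using fl0 fix_fl by (simp_all add: fp_arith_def fp_numbers_uminus)
  next
    fix x :: real and i m :: nat
    assume "x \<in> fp_numbers p emax" "i < m"
    from summation[OF this]
    show "ar_sum (fp_arith fl S) (map (\<lambda>k. Finite (if k = i then x else 0)) [0..<m]) = Finite x"
      by (simp add: fp_arith_def)
  qed (simp_all add: zero fp_arith_def)
qed

section \<open>The exact run of the algorithm\<close>

text \<open>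
  Uniqueness of the assigned value replaces an argument about the order of the assignments.
\<close>
lemma coeffs_of_eq_Some:
  assumes "Coeff i j h \<in> set tr" and "\<And>h'. Coeff i j h' \<in> set tr \<Longrightarrow> h' = h"
  shows "coeffs_of tr (i, j) = Some h"
proof -
  define al where "al = [((i, j), h). Coeff i j h \<leftarrow> tr]"
  have iff: "((i, j), h') \<in> set al \<longleftrightarrow> Coeff i j h' \<in> set tr" for h'
    unfolding al_def by (force split: assignment.splits)
  from iff[of h] assms(1) have "(i, j) \<in> fst ` set al" by force
  hence "map_of al (i, j) \<noteq> None" by (simp add: map_of_eq_None_iff)
  then obtain h' where h': "map_of al (i, j) = Some h'" by blast
  hence "h' = h" using iff assms(2) map_of_SomeD by metis
  thus ?thesis using h' unfolding coeffs_of_def al_def by simp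
qed

text \<open>
  The permutation \<open>\<pi>\<close> and the signs \<open>s\<close> encode the matrix \<open>P\<close>, whose column \<open>j\<close> is \<open>s j\<close> times the
  coordinate vector \<open>\<pi> j\<close>.  All indices start at 0 here, whereas those of the assignments start at 1.
\<close>
locale signed_hessenberg =
  fixes n :: nat and \<pi> :: "nat \<Rightarrow> nat" and s :: "nat \<Rightarrow> real" and H :: "real mat"
  assumes perm: "\<pi> permutes {..<n}"
    and sign: "j < n \<Longrightarrow> s j \<in> {1, -1}"
    and H_carrier: "H \<in> carrier_mat n n"
    and hess: "upper_hessenberg H"
begin

text \<open>
  Coordinate \<open>k\<close> is the one in which the basis vector number \<open>pos k\<close> is supported.
\<close>
abbreviation pos :: "nat \<Rightarrow> nat" where
  "pos \<equiv> inv_into UNIV \<pi>"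

definition basis :: "nat \<Rightarrow> real vec" where
  "basis j = s j \<cdot>\<^sub>v unit_vec n (\<pi> j)"

text \<open>
  The working vector of iteration \<open>j\<close> after the components along the first \<open>i\<close> basis vectors have
  been removed; at the start it is \<open>P\<close> applied to column \<open>j\<close> of \<open>H\<close>.
\<close>
definition residual :: "nat \<Rightarrow> nat \<Rightarrow> real vec" where
  "residual j i = vec n (\<lambda>k. let l = pos k in if l < i then 0 else s l * H $$ (l, j))"

text \<open>
  The value \<open>0\<close> in row \<open>n\<close> is the norm on which the algorithm stops after its last iteration.
\<close>
definition coeff :: "nat \<Rightarrow> nat \<Rightarrow> real" where
  "coeff i j = (if i < n then H $$ (i, j) else 0)"

definition inner_trace :: "nat \<Rightarrow> nat \<Rightarrow> (real vec, real) assignment list" where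
  "inner_trace j i = concat (map (\<lambda>l. [Coeff (l + 1) (j + 1) (coeff l j), Work (residual j (l + 1))])
     [i..<j + 1])"

definition outer_trace :: "nat \<Rightarrow> (real vec, real) assignment list" where
  "outer_trace j = Work (residual j 0) # inner_trace j 0 @
     Coeff (j + 2) (j + 1) (coeff (j + 1) j) # (if j + 1 < n then [Basis (j + 2) (basis (j + 1))] else [])"

definition full_trace :: "(real vec, real) assignment list" where
  "full_trace = Basis 1 (basis 0) # concat (map outer_trace [0..<n])"

lemma pi_less_iff: "\<pi> j < n \<longleftrightarrow> j < n"
  using permutes_in_image[OF perm, of j] by simp

lemma inv_pi: "pos (\<pi> j) = j" "\<pi> (pos j) = j"
  using permutes_inverses[OF perm] by auto

lemma inv_pi_less_iff: "pos k < n \<longleftrightarrow> k < n"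
  using pi_less_iff[of "pos k"] inv_pi by simp

lemma residual_carrier: "residual j i \<in> carrier_vec n"
  by (simp add: residual_def)

lemma residual_at_pi: "i < n \<Longrightarrow> residual j i $ \<pi> i = s i * H $$ (i, j)"
  by (simp add: residual_def inv_pi pi_less_iff)

lemma residual_Suc:
  "residual j (Suc i) = vec n (\<lambda>k. if k = \<pi> i then 0 else residual j i $ k)"
proof -
  have "k = \<pi> i \<longleftrightarrow> pos k = i" for k using inv_pi by metis
  thus ?thesis by (auto simp: residual_def Let_def less_Suc_eq)
qed

text \<open>
  The Hessenberg form is what makes the working vector a multiple of the next basis vector.  For
  \<open>j = n - 1\<close> both sides are zero, through the factor \<open>coeff n j = 0\<close>.
\<close>
lemma residual_final:
  assumes "j < n"
  shows "residual j (j + 1) = (s (j + 1) * coeff (j + 1) j) \<cdot>\<^sub>v unit_vec n (\<pi> (j + 1))"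
proof (rule eq_vecI)
  fix k assume "k < dim_vec ((s (j + 1) * coeff (j + 1) j) \<cdot>\<^sub>v unit_vec n (\<pi> (j + 1)))"
  hence k: "k < n" by simp
  hence l: "pos k < n" by (simp add: inv_pi_less_iff)
  have "k = \<pi> (j + 1) \<longleftrightarrow> pos k = j + 1" using inv_pi by metis
  moreover have "H $$ (pos k, j) = 0" if "j + 1 < pos k"
    using that hess l assms H_carrier by (auto simp: upper_hessenberg_def)
  ultimately show "residual j (j + 1) $ k
      = ((s (j + 1) * coeff (j + 1) j) \<cdot>\<^sub>v unit_vec n (\<pi> (j + 1))) $ k"
    using k l by (auto simp: residual_def Let_def unit_vec_def coeff_def)
qed (simp add: residual_def)

lemma residual_final_last: "n \<ge> 1 \<Longrightarrow> residual (n - 1) n = 0\<^sub>v n"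
  by (auto simp: residual_def Let_def inv_pi_less_iff)

lemma Coeff_in_inner_trace_iff:
  "Coeff i j h \<in> set (inner_trace l 0) \<longleftrightarrow> j = l + 1 \<and> 1 \<le> i \<and> i \<le> l + 1 \<and> h = coeff (i - 1) l"
  by (cases i) (auto simp: inner_trace_def less_Suc_eq_le simp del: upt_Suc)

lemma Coeff_in_outer_trace_iff:
  "Coeff i j h \<in> set (outer_trace l) \<longleftrightarrow> j = l + 1 \<and> 1 \<le> i \<and> i \<le> l + 2 \<and> h = coeff (i - 1) l"
proof -
  have "i \<le> l + 2 \<longleftrightarrow> i \<le> l + 1 \<or> i = l + 2" by linarith
  moreover have "Coeff i j h \<in> set (outer_trace l) \<longleftrightarrow>
     Coeff i j h \<in> set (inner_trace l 0) \<or> (i = l + 2 \<and> j = l + 1 \<and> h = coeff (i - 1) l)"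
    by (auto simp: outer_trace_def)
  ultimately show ?thesis unfolding Coeff_in_inner_trace_iff by auto
qed

lemma Coeff_in_full_trace_iff:
  "Coeff i j h \<in> set full_trace \<longleftrightarrow>
     1 \<le> j \<and> j \<le> n \<and> 1 \<le> i \<and> i \<le> j + 1 \<and> h = coeff (i - 1) (j - 1)"
proof -
  have "Coeff i j h \<in> set full_trace \<longleftrightarrow> (\<exists>l<n. Coeff i j h \<in> set (outer_trace l))"
    by (auto simp: full_trace_def)
  thus ?thesis unfolding Coeff_in_outer_trace_iff by (cases j) auto
qed

lemma coeffs_of_embedded_trace:
  assumes "i < n" "j < n" "i \<le> j + 1"
  shows "coeffs_of (map (map_assignment g c) full_trace) (i + 1, j + 1) = Some (c (H $$ (i, j)))"
proof (rule coeffs_of_eq_Some)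
  have "Coeff (i + 1) (j + 1) (H $$ (i, j)) \<in> set full_trace"
    using assms by (simp add: Coeff_in_full_trace_iff coeff_def)
  thus "Coeff (i + 1) (j + 1) (c (H $$ (i, j))) \<in> set (map (map_assignment g c) full_trace)"
    by force
next
  fix h' assume "Coeff (i + 1) (j + 1) h' \<in> set (map (map_assignment g c) full_trace)"
  then obtain a where a: "a \<in> set full_trace" "Coeff (i + 1) (j + 1) h' = map_assignment g c a"
    by auto
  obtain h where "a = Coeff (i + 1) (j + 1) h" "h' = c h" using a(2) by (cases a) auto
  thus "h' = c (H $$ (i, j))" using a(1) assms by (simp add: Coeff_in_full_trace_iff coeff_def)
qed

lemma arnoldi_hessenberg_embedded_trace:
  assumes "ar_zero ar = c 0"
  shows "arnoldi_hessenberg ar n (map (map_assignment g c) full_trace) = Some (map_mat c H)"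
proof -
  let ?C = "coeffs_of (map (map_assignment g c) full_trace)"
  have dom: "(i, j) \<in> dom ?C" if "j \<in> {1..n}" "i \<in> {1..min n (j + 1)}" for i j
    using that coeffs_of_embedded_trace[of "i - 1" "j - 1" g c] by force
  have "mat n n (\<lambda>(i, j). if i \<le> j + 1 then the (?C (i + 1, j + 1)) else ar_zero ar) = map_mat c H"
  proof (rule eq_matI)
    fix i j assume "i < dim_row (map_mat c H)" "j < dim_col (map_mat c H)"
    hence ij: "i < n" "j < n" using H_carrier by auto
    have "H $$ (i, j) = 0" if "\<not> i \<le> j + 1"
      using that hess ij H_carrier by (auto simp: upper_hessenberg_def)
    thus "mat n n (\<lambda>(i, j). if i \<le> j + 1 then the (?C (i + 1, j + 1)) else ar_zero ar) $$ (i, j)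
        = map_mat c H $$ (i, j)"
      using ij H_carrier assms coeffs_of_embedded_trace[OF ij, of g c] by auto
  qed (use H_carrier in auto)
  thus ?thesis using dom unfolding arnoldi_hessenberg_def by auto
qed


definition perm_mat :: "real mat" where
  "perm_mat = mat n n (\<lambda>(i, j). if i = \<pi> j then s j else 0)"

lemma perm_mat_dim [simp]: "dim_row perm_mat = n" "dim_col perm_mat = n"
  by (simp_all add: perm_mat_def)

lemma row_perm_mat:
  assumes "k < n"
  shows "row perm_mat k = s (pos k) \<cdot>\<^sub>v unit_vec n (pos k)"
proof -
  have "k = \<pi> i \<longleftrightarrow> i = pos k" for i using inv_pi by metis
  thus ?thesis using assms by (auto simp: perm_mat_def unit_vec_def)
qed

lemma conjugate_index:
  assumes "k < n" "l < n"
  shows "(perm_mat * H * perm_mat\<^sup>T) $$ (k, l) = s (pos k) * s (pos l) * H $$ (pos k, pos l)"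
proof -
  have P: "perm_mat \<in> carrier_mat n n" by (simp add: perm_mat_def)
  have PH: "(perm_mat * H) $$ (k, b) = s (pos k) * H $$ (pos k, b)" if "b < n" for b
    using that assms P H_carrier row_perm_mat[OF assms(1)] inv_pi_less_iff
    by (simp add: scalar_prod_left_unit)
  have "(perm_mat * H * perm_mat\<^sup>T) $$ (k, l) = row (perm_mat * H) k \<bullet> row perm_mat l"
    using assms P H_carrier by (subst index_mult_mat(1)) auto
  also have "\<dots> = s (pos l) * (perm_mat * H) $$ (k, pos l)"
    using assms P H_carrier row_perm_mat[OF assms(2)] inv_pi_less_iff
    by (simp add: scalar_prod_right_unit)
  finally show ?thesis using PH[of "pos l"] assms inv_pi_less_iff by simp
qed

lemma conjugate_carrier: "perm_mat * H * perm_mat\<^sup>T \<in> carrier_mat n n"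
  using H_carrier by (auto simp: perm_mat_def)

text \<open>
  The sign of the basis vector cancels against the one that \<open>P\<^sup>T\<close> puts into the matrix.
\<close>
lemma conjugate_col:
  assumes "j < n"
  shows "s j \<cdot>\<^sub>v col (perm_mat * H * perm_mat\<^sup>T) (\<pi> j) = residual j 0"
proof (rule eq_vecI)
  fix k assume "k < dim_vec (residual j 0)"
  hence k: "k < n" by (simp add: residual_def)
  have "s j * s j = 1" using sign[OF assms] by auto
  moreover have "(s j \<cdot>\<^sub>v col (perm_mat * H * perm_mat\<^sup>T) (\<pi> j)) $ k
      = s j * (perm_mat * H * perm_mat\<^sup>T) $$ (k, \<pi> j)"
    using k assms pi_less_iff by (simp del: index_mult_mat(1))
  ultimately show "(s j \<cdot>\<^sub>v col (perm_mat * H * perm_mat\<^sup>T) (\<pi> j)) $ k = residual j 0 $ k"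
    using k assms conjugate_index[OF k, of "\<pi> j"] pi_less_iff inv_pi
    by (simp add: residual_def Let_def)
qed (simp add: residual_def)

lemma perm_mat_first_col: "n \<ge> 1 \<Longrightarrow> perm_mat *\<^sub>v unit_vec n 0 = basis 0"
proof (rule eq_vecI)
  fix k assume "n \<ge> 1" "k < dim_vec (basis 0)"
  hence "0 < n" "k < n" by (auto simp: basis_def)
  thus "(perm_mat *\<^sub>v unit_vec n 0) $ k = basis 0 $ k"
    using pi_less_iff[of 0] by (simp add: basis_def perm_mat_def scalar_prod_right_unit)
qed (simp add: basis_def)

end

section \<open>The run in a sparsely exact arithmetic\<close>

text \<open>
  Both parts together: the data are represented faithfully, and the subdiagonal entries, which
  are the norms, are admissible.
\<close>
locale arnoldi_sparse = sparse_exact_arith ar emb F N + signed_hessenberg n \<pi> s H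
  for ar :: "'a arith" and emb F N n \<pi> s H +
  assumes H_in_F: "elements_mat H \<subseteq> F"
    and subdiag: "j + 1 < n \<Longrightarrow> H $$ (j + 1, j) \<in> N"
begin

abbreviation embed_trace :: "(real vec, real) assignment list \<Rightarrow> ('a vec, 'a) assignment list" where
  "embed_trace \<equiv> map (map_assignment (map_vec emb) emb)"

lemma sign': "j < n \<Longrightarrow> s j \<in> {-1, 1}"
  using sign by blast

lemma residual_in_F:
  assumes "j < n" "k < n"
  shows "residual j i $ k \<in> F"
proof -
  have l: "pos k < n" using assms by (simp add: inv_pi_less_iff)
  hence "H $$ (pos k, j) \<in> F" using subsetD[OF H_in_F elements_matI[OF H_carrier]] assms by blast
  thus ?thesis using assms sign[OF l] zero_in_F
    by (auto simp: residual_def Let_def intro!: sign_mult_in_F)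
qed

text \<open>
  Each step of the loop clears exactly one coordinate of the working vector and records the
  corresponding entry of \<open>H\<close>.
\<close>
lemma orthogonalize_residual:
  assumes "j < n" "i \<le> j + 1"
  shows "orthogonalize ar (j + 1) (i + 1) (map (\<lambda>l. map_vec emb (basis l)) [i..<j + 1])
      (map_vec emb (residual j i))
    = (embed_trace (inner_trace j i), map_vec emb (residual j (j + 1)))"
  using assms(2)
proof (induction i rule: inc_induct)
  case base
  show ?case by (simp add: inner_trace_def)
next
  case (step i)
  hence i: "i < n" "\<pi> i < n" using assms(1) pi_less_iff by auto
  note F = residual_in_F[OF assms(1)]
  have "s i * residual j i $ \<pi> i = coeff i j"
    using i sign[of i] by (auto simp: residual_at_pi coeff_def)
  hence h: "ar_inner ar (map_vec emb (basis i)) (map_vec emb (residual j i)) = emb (coeff i j)"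
    and w: "ar_sub_scaled ar (map_vec emb (residual j i)) (emb (coeff i j)) (map_vec emb (basis i))
      = map_vec emb (residual j (Suc i))"
    using inner_sign_left[OF i(2) sign'[OF i(1)] F residual_carrier, of i]
      sub_scaled_sign[OF i(2) sign'[OF i(1)] F residual_carrier, of i]
    by (simp_all add: basis_def residual_Suc)
  have upt: "[i..<j + 1] = i # [Suc i..<j + 1]" using step.hyps by (simp add: upt_conv_Cons)
  show ?case using step.IH
    unfolding inner_trace_def upt by (simp add: h w Let_def)
qed

text \<open>
  One unfolding of the outer loop, before the norm is tested for zero; the final iteration and
  the others differ only in the outcome of that test.
\<close>
lemma arnoldi_iterate_step:
  assumes A: "A \<in> carrier_mat n n" "elements_mat A \<subseteq> F"
    and col: "s j \<cdot>\<^sub>v col A (\<pi> j) = residual j 0"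
    and j: "j < n"
    and norm: "ar_norm ar (map_vec emb (residual j (j + 1))) = emb (coeff (j + 1) j)"
  shows "arnoldi_iterate ar (map_mat emb A) (Suc m) (map (\<lambda>l. map_vec emb (basis l)) [0..<j + 1])
    = embed_trace (Work (residual j 0) # inner_trace j 0 @ [Coeff (j + 2) (j + 1) (coeff (j + 1) j)]) @
      (if emb (coeff (j + 1) j) = emb 0 then []
       else let v' = ar_div_vec ar (map_vec emb (residual j (j + 1))) (emb (coeff (j + 1) j))
            in Basis (j + 2) v' # arnoldi_iterate ar (map_mat emb A) m
                 (map (\<lambda>l. map_vec emb (basis l)) [0..<j + 1] @ [v']))"
proof -
  have w: "ar_mult_mat_vec ar (map_mat emb A) (map_vec emb (basis j)) = map_vec emb (residual j 0)"
    using mult_mat_vec_sign[OF _ sign'[OF j] A(2,1), of "\<pi> j"] col pi_less_iff j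
    unfolding basis_def by simp
  show ?thesis
    using orthogonalize_residual[OF j, of 0] w norm by (simp add: Let_def emb_zero)
qed

lemma arnoldi_iterate_eq:
  assumes A: "A \<in> carrier_mat n n" "elements_mat A \<subseteq> F"
    and cols: "\<And>j. j < n \<Longrightarrow> s j \<cdot>\<^sub>v col A (\<pi> j) = residual j 0"
    and "j < n"
  shows "arnoldi_iterate ar (map_mat emb A) (n - j) (map (\<lambda>l. map_vec emb (basis l)) [0..<j + 1])
    = embed_trace (concat (map outer_trace [j..<n]))"
proof -
  have "j \<le> n - 1" using assms(4) by simp
  thus ?thesis
  proof (induction j rule: inc_induct)
    case base
    hence n: "n - 1 < n" "n - 1 + 1 = n" using assms(4) by auto
    have c: "coeff (n - 1 + 1) (n - 1) = 0" using n by (simp add: coeff_def)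
    have "ar_norm ar (map_vec emb (residual (n - 1) n)) = emb 0"
      using norm_zero residual_final_last n by simp
    hence "ar_norm ar (map_vec emb (residual (n - 1) (n - 1 + 1))) = emb (coeff (n - 1 + 1) (n - 1))"
      using c unfolding n(2) by simp
    note step = arnoldi_iterate_step[OF A cols[OF n(1)] n(1) this, of 0, unfolded c]
    have "n - (n - 1) = Suc 0" "[n - 1..<n] = [n - 1]" "\<not> n - 1 + 1 < n"
      using n by (simp_all add: upt_conv_Cons)
    thus ?case using step c n by (simp only: outer_trace_def if_False) simp
  next
    case (step j)
    hence j: "j < n" "j + 1 < n" by auto
    have N: "coeff (j + 1) j \<in> N" using subdiag[OF j(2)] j by (simp add: coeff_def)
    have h: "ar_norm ar (map_vec emb (residual j (j + 1))) = emb (coeff (j + 1) j)"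
      unfolding residual_final[OF j(1)]
      using norm_single[OF N sign'[OF j(2)]] pi_less_iff j by simp
    have v: "ar_div_vec ar (map_vec emb (residual j (j + 1))) (emb (coeff (j + 1) j))
        = map_vec emb (basis (j + 1))"
      unfolding residual_final[OF j(1)] basis_def by (rule div_vec_pivot[OF sign'[OF j(2)] N])
    have nj: "n - j = Suc (n - Suc j)" and upt: "[j..<n] = j # [Suc j..<n]"
      using j by (simp_all add: upt_conv_Cons)
    show ?case
      using arnoldi_iterate_step[OF A cols[OF j(1)] j(1) h, of "n - Suc j"] v step.IH
        emb_nonzero[OF N] j(2)
      unfolding nj upt by (simp add: Let_def outer_trace_def)
  qed
qed

lemma arnoldi_eq_full_trace:
  assumes A: "A \<in> carrier_mat n n" "elements_mat A \<subseteq> F"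
    and cols: "\<And>j. j < n \<Longrightarrow> s j \<cdot>\<^sub>v col A (\<pi> j) = residual j 0"
    and "n \<ge> 1" "h10 \<in> N"
  shows "arnoldi ar (map_mat emb A) (map_vec emb (h10 \<cdot>\<^sub>v basis 0)) = embed_trace full_trace"
proof -
  have n: "0 < n" "\<pi> 0 < n" using assms(4) pi_less_iff by auto
  have v: "h10 \<cdot>\<^sub>v basis 0 = (s 0 * h10) \<cdot>\<^sub>v unit_vec n (\<pi> 0)"
    by (simp add: basis_def smult_smult_assoc mult.commute)
  have "ar_div_vec ar (map_vec emb (h10 \<cdot>\<^sub>v basis 0)) (ar_norm ar (map_vec emb (h10 \<cdot>\<^sub>v basis 0)))
      = map_vec emb (basis 0)"
    unfolding v norm_single[OF assms(5) sign'[OF n(1)] n(2)]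
    by (simp add: basis_def div_vec_pivot[OF sign'[OF n(1)] assms(5)])
  thus ?thesis using arnoldi_iterate_eq[OF A cols n(1)] A(1)
    by (simp add: arnoldi_def full_trace_def)
qed

text \<open>
  The right-hand side depends on the arithmetic through its embedding only; this is what allows
  the comparison of two arithmetics.
\<close>
lemma arnoldi_conjugate:
  assumes "n \<ge> 1" "h10 \<in> N"
  shows "arnoldi ar (map_mat emb (perm_mat * H * perm_mat\<^sup>T))
      (map_vec emb (h10 \<cdot>\<^sub>v (perm_mat *\<^sub>v unit_vec n 0))) = embed_trace full_trace"
proof -
  have "elements_mat (perm_mat * H * perm_mat\<^sup>T) \<subseteq> F"
  proof
    fix a assume "a \<in> elements_mat (perm_mat * H * perm_mat\<^sup>T)"
    then obtain k l where kl: "k < n" "l < n" and a: "a = (perm_mat * H * perm_mat\<^sup>T) $$ (k, l)"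
      using elements_matD[of a] by fastforce
    have "H $$ (pos k, pos l) \<in> F"
      using subsetD[OF H_in_F elements_matI[OF H_carrier]] kl inv_pi_less_iff by blast
    moreover have "s (pos k) * s (pos l) \<in> {-1, 0, 1}"
    proof -
      have "s (pos k) \<in> {1, -1}" "s (pos l) \<in> {1, -1}"
        using kl sign inv_pi_less_iff by blast+
      thus ?thesis by auto
    qed
    ultimately show "a \<in> F" unfolding a conjugate_index[OF kl] by (rule sign_mult_in_F)
  qed
  from arnoldi_eq_full_trace[OF conjugate_carrier this conjugate_col assms]
  show ?thesis unfolding perm_mat_first_col[OF assms(1)] .
qed

end

section \<open>Exactness of the Arnoldi algorithm\<close>

theorem theorem6p1:
  fixes p n :: nat and emax :: int
    and fl :: "real \<Rightarrow> fpval" and S :: "fpval list \<Rightarrow> fpval"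
    and A P H :: "real mat" and v :: "real vec" and h10 :: real
  assumes "binary_format p emax"
    and "round_to_nearest p emax fl"
    and "fp_summation fl S"
    and "n \<ge> 1"
    and "signed_permutation_mat n P" and "elements_mat P \<subseteq> fp_numbers p emax"
    and "H \<in> carrier_mat n n" and "elements_mat H \<subseteq> fp_numbers p emax"
    and "upper_hessenberg H"
    and "h10 \<in> fp_numbers p emax"
    and "h10 > 0" and "within_exponent_range p emax (h10\<^sup>2)"
    and "\<forall>j. j + 1 < n \<longrightarrow>
           H $$ (j + 1, j) > 0 \<and> within_exponent_range p emax ((H $$ (j + 1, j))\<^sup>2)"
    and "A = P * H * P\<^sup>T"
    and "v = h10 \<cdot>\<^sub>v (P *\<^sub>v unit_vec n 0)"
  shows "arnoldi_computes_exactly fl S A v \<and>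
         arnoldi_hessenberg (fp_arith fl S) n (arnoldi_fp fl S A v) = Some (map_mat Finite H)"
proof -
  obtain \<pi> s where \<pi>: "\<pi> permutes {..<n}" and s: "\<forall>j<n. s j \<in> {1, -1}"
    and P: "P = mat n n (\<lambda>(i, j). if i = \<pi> j then s j else 0)"
    using assms(5) unfolding signed_permutation_mat_def by blast
  interpret signed_hessenberg n \<pi> s H
    using \<pi> s assms(7,9) by unfold_locales auto
  let ?N = "{h \<in> fp_numbers p emax. h > 0 \<and> within_exponent_range p emax (h\<^sup>2)}"
  have P: "P = perm_mat" using P unfolding perm_mat_def .
  have N: "H $$ (j + 1, j) \<in> ?N" if "j + 1 < n" for j
    using subsetD[OF assms(8) elements_matI[OF assms(7)], of "j + 1" j] that assms(13) by auto
  interpret exact: sparse_exact_arith exact_arith id UNIV "{0<..}"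
    by (rule exact_arith_sparse)
  interpret exact: arnoldi_sparse exact_arith id UNIV "{0<..}" n \<pi> s H
    using N by unfold_locales auto
  interpret fp: sparse_exact_arith "fp_arith fl S" Finite "fp_numbers p emax" ?N
    by (rule fp_arith_sparse[OF assms(1-3)])
  interpret fp: arnoldi_sparse "fp_arith fl S" Finite "fp_numbers p emax" ?N n \<pi> s H
    using N assms(8) by unfold_locales auto
  have id: "map_mat id A = A" "map_vec id = (id :: real vec \<Rightarrow> real vec)"
    by (auto simp: fun_eq_iff)
  have "arnoldi exact_arith (map_mat id A) (map_vec id v)
      = map (map_assignment (map_vec id) id) full_trace"
    unfolding assms(14,15) P by (rule exact.arnoldi_conjugate) (use assms(4,11) in auto)
  hence exact: "arnoldi exact_arith A v = full_trace"
    by (simp add: id assignment.map_id0)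
  have fp: "arnoldi_fp fl S A v = map (map_assignment (map_vec Finite) Finite) full_trace"
    unfolding arnoldi_fp_def assms(14,15) P
    by (rule fp.arnoldi_conjugate) (use assms(4,10-12) in auto)
  show ?thesis
    unfolding arnoldi_computes_exactly_def exact fp
    by (simp add: arnoldi_hessenberg_embedded_trace fp_arith_def)
qed

end
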